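(* Let $(\mathcal X,\mathcal A)$ be a measurable space, let $\mathcal P=\{P_\theta:\theta\in\Theta\}\subseteq\mathrm{Prob}(\mathcal X,\mathcal A)$ be a model with $\Theta=\Theta_1\times\Theta_2$, and let $\mathcal C_1,\mathcal C_2$ be sub-$\sigma$-algebras of $\mathcal A$ with these properties: (i) For each $\theta_2\in\Theta_2$, $\mathcal C_1$ is complete and sufficient for $\{P_{\theta_1,\theta_2}:\theta_1\in\Theta_1\}$. (ii) For each $\theta_1\in\Theta_1$, $\mathcal C_2$ is complete and sufficient for $\{P_{\theta_1,\theta_2}:\theta_2\in\Theta_2\}$. Then $\mathcal C_1\vee\mathcal C_2$ is complete for $\mathcal P$.
   Context: $\mathrm{Prob}(\mathcal X,\mathcal A)$ denotes the set of all probability measures (laws) on $(\mathcal X,\mathcal A)$. A model on $(\mathcal X,\mathcal A)$ is a subset of $\mathrm{Prob}(\mathcal X,\mathcal A)$. For a law $P$ and a function $h$, $Ph$ denotes $\int h\,dP$. A sub-$\sigma$-algebra $\mathcal C\subseteq\mathcal A$ is complete for a model $\mathcal P$ if every $\mathcal C$-measurable $h:\mathcal X\to\mathbb R$ that is integrable with respect to every $P\in\mathcal P$ and satisfies $Ph=0$ for all $P\in\mathcal P$ also satisfies $h=0$ $P$-a.s. for every $P\in\mathcal P$. A sub-$\sigma$-algebra $\mathcal C$ is sufficient for $\mathcal P$ if for every $A\in\mathcal A$ there is a $\mathcal C$-measurable function that is a version of the conditional probability $P(A\,|\,\mathcal C)$ simultaneously for all $P\in\mathcal P$. $\mathcal C_1\vee\mathcal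 C_2$ denotes the $\sigma$-algebra generated by $\mathcal C_1\cup\mathcal C_2$. *)

theory Defs
  imports "HOL-Probability.Probability"
begin

text \<open>
  A \<open>\<sigma>\<close>-algebra is represented by a value of type \<open>'a measure\<close> of which only \<open>space\<close> and \<open>sets\<close>
  matter; \<open>subalgebra M C\<close> says that \<open>C\<close> is a sub-\<open>\<sigma>\<close>-algebra of \<open>M\<close>. The set of all laws on the
  measurable space \<open>M\<close> is \<open>space (prob_algebra M)\<close>, and a model on \<open>M\<close> is a subset of it.
\<close>

definition complete_for :: "'a measure \<Rightarrow> 'a measure set \<Rightarrow> bool" where
  "complete_for C \<P> \<longleftrightarrow>
     (\<forall>h :: 'a \<Rightarrow> real. h \<in> borel_measurable C \<longrightarrow>
        (\<forall>P\<in>\<P>. integrable P h) \<longrightarrow> (\<forall>P\<in>\<P>. (\<integral>x. h x \<partial>P) = 0) \<longrightarrow>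
        (\<forall>P\<in>\<P>. AE x in P. h x = 0))"

text \<open>
  \<open>real_cond_exp P C (indicator A)\<close> is one fixed version of \<open>P(A | C)\<close>; the versions of \<open>P(A | C)\<close> are
  the \<open>C\<close>-measurable functions that agree with it \<open>P\<close>-almost surely.
\<close>

definition cond_prob_version ::
    "'a measure \<Rightarrow> 'a measure \<Rightarrow> 'a set \<Rightarrow> ('a \<Rightarrow> real) \<Rightarrow> bool" where
  "cond_prob_version P C A f \<longleftrightarrow>
     f \<in> borel_measurable C \<and> (AE x in P. f x = real_cond_exp P C (indicator A) x)"

definition sufficient_for :: "'a measure \<Rightarrow> 'a measure \<Rightarrow> 'a measure set \<Rightarrow> bool" where
  "sufficient_for M C \<P> \<longleftrightarrow>
     (\<forall>A\<in>sets M. \<exists>f\<in>borel_measurable C. \<forall>P\<in>\<P>. cond_prob_version P C A f)"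

end

theory Submission
  imports Defs
begin

text \<open>
  Let \<open>h\<close> be measurable for the join of \<open>C1\<close> and \<open>C2\<close>, and integrable with integral \<open>0\<close> under
  every law \<open>P (\<theta>1, \<theta>2)\<close>.

  Everything rests on one fact about a sub-\<open>\<sigma>\<close>-algebra \<open>C\<close> that is complete and sufficient for a
  model: if an \<open>M\<close>-measurable \<open>f\<close> is integrable with integral \<open>0\<close> under every law of the model,
  then its integral over each set of \<open>C\<close> also vanishes under every law
  (\<open>complete_sufficient_imp_set_integral_zero\<close>). Indeed, sufficiency provides a single version \<open>g\<close>
  of the conditional expectation of \<open>f\<close> given \<open>C\<close> that serves all laws at once; \<open>g\<close> is
  \<open>C\<close>-measurable and has the same integrals as \<open>f\<close>, namely \<open>0\<close>, so completeness makes it vanish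
  almost surely.

  For \<open>A \<in> C1\<close>, the fact applied to \<open>h\<close> along \<open>\<theta>1\<close>, with \<open>\<theta>2\<close> held fixed, shows that the
  integral of \<open>h\<close> over \<open>A\<close> vanishes; since \<open>\<theta>2\<close> was arbitrary, this holds under all the laws.
  Hence the fact applies again, now along \<open>\<theta>2\<close> and to \<open>h\<close> restricted to \<open>A\<close>, a function that need
  not be measurable for \<open>C2\<close>: this is why the fact is wanted for all \<open>M\<close>-measurable functions. The
  result is that the integral of \<open>h\<close> over \<open>A \<inter> B\<close> vanishes for all \<open>A \<in> C1\<close> and \<open>B \<in> C2\<close>. These
  intersections form a \<open>\<pi>\<close>-system that generates the join, so the integral of \<open>h\<close> over every set of
  the join vanishes, and \<open>h = 0\<close> almost surely.
\<close>

section \<open>Monotone convergence of conditional expectations\<close>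

text \<open>
  The conditional expectations of \<open>U i\<close> increase almost surely and are bounded by that of \<open>u\<close>, so
  they have some limit; integrating over the sets of \<open>F\<close> identifies it.
\<close>

lemma (in sigma_finite_subalgebra) real_cond_exp_monotone_convergence:
  fixes U :: "nat \<Rightarrow> 'a \<Rightarrow> real"
  assumes intU: "\<And>i. integrable M (U i)"
    and intu: "integrable M u"
    and nonneg: "\<And>i x. 0 \<le> U i x"
    and mono: "incseq U"
    and lim: "\<And>x. x \<in> space M \<Longrightarrow> (\<lambda>i. U i x) \<longlonglongrightarrow> u x"
  shows "AE x in M. (\<lambda>i. real_cond_exp M F (U i) x) \<longlonglongrightarrow> real_cond_exp M F u x"
proof -
  let ?E = "real_cond_exp M F"
  define g where "g x = lim (\<lambda>i. ?E (U i) x)" for x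
  have F_sets: "A \<in> sets M" if "A \<in> sets F" for A
    using subalg that by (auto simp: subalgebra_def)
  have U_le: "U i x \<le> u x" if "x \<in> space M" for i x
    using lim[OF that] mono by (intro incseq_le) (auto simp: incseq_def le_fun_def)
  have "AE x in M. ?E (U i) x \<le> ?E (U (Suc i)) x" for i
    using mono by (intro real_cond_exp_mono intU AE_I2) (auto simp: incseq_Suc_iff le_fun_def)
  then have AE_mono: "AE x in M. \<forall>i. ?E (U i) x \<le> ?E (U (Suc i)) x"
    by (simp add: AE_all_countable)
  have "AE x in M. ?E (U i) x \<le> ?E u x" for i
    using U_le by (intro real_cond_exp_mono intU intu AE_I2) auto
  then have AE_le: "AE x in M. \<forall>i. ?E (U i) x \<le> ?E u x"
    by (simp add: AE_all_countable)
  have "AE x in M. 0 \<le> ?E (U i) x" for i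
    using nonneg by (intro real_cond_exp_pos borel_measurable_integrable intU) auto
  then have AE_nonneg: "AE x in M. \<forall>i. 0 \<le> ?E (U i) x"
    by (simp add: AE_all_countable)
  have AE_lim: "AE x in M. (\<lambda>i. ?E (U i) x) \<longlonglongrightarrow> g x"
    using AE_mono AE_le
  proof eventually_elim
    case (elim x)
    then obtain l where "(\<lambda>i. ?E (U i) x) \<longlonglongrightarrow> l"
      by (metis incseq_convergent incseq_SucI)
    then show ?case by (simp add: g_def limI)
  qed
  have g_F: "g \<in> borel_measurable F"
    unfolding g_def by measurable
  have g_M: "g \<in> borel_measurable M"
    by (rule measurable_from_subalg[OF subalg g_F])
  have AE_norm: "AE x in M. norm (?E (U i) x) \<le> ?E u x" for i
    using AE_le AE_nonneg by eventually_elim auto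
  have intg: "integrable M g"
    by (rule integrable_dominated_convergence[OF g_M _ real_cond_exp_int(1)[OF intu] AE_lim AE_norm])
       auto
  have "AE x in M. ?E u x = g x"
  proof (rule real_cond_exp_charact[OF _ intu intg g_F])
    fix A assume A: "A \<in> sets F"
    note AM = F_sets[OF A]
    have 1: "(\<lambda>i. \<integral>x\<in>A. U i x \<partial>M) \<longlonglongrightarrow> (\<integral>x\<in>A. u x \<partial>M)"
      unfolding set_lebesgue_integral_def
    proof (rule integral_dominated_convergence[where w = u])
      show "AE x in M. (\<lambda>i. indicator A x *\<^sub>R U i x) \<longlonglongrightarrow> indicator A x *\<^sub>R u x"
        using lim by (intro AE_I2 tendsto_intros)
      show "AE x in M. norm (indicator A x *\<^sub>R U i x) \<le> u x" for i
        using U_le nonneg order_trans[OF nonneg U_le]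
        by (intro AE_I2) (auto simp: indicator_def)
    qed (use AM intu intU in \<open>auto intro!: borel_measurable_integrable integrable_mult_indicator\<close>)
    have 2: "(\<lambda>i. \<integral>x\<in>A. ?E (U i) x \<partial>M) \<longlonglongrightarrow> (\<integral>x\<in>A. g x \<partial>M)"
      unfolding set_lebesgue_integral_def
    proof (rule integral_dominated_convergence[where w = "?E u"])
      show "AE x in M. (\<lambda>i. indicator A x *\<^sub>R ?E (U i) x) \<longlonglongrightarrow> indicator A x *\<^sub>R g x"
        using AE_lim by eventually_elim (intro tendsto_intros)
      show "AE x in M. norm (indicator A x *\<^sub>R ?E (U i) x) \<le> ?E u x" for i
        using AE_le AE_nonneg
        by eventually_elim (auto simp: indicator_def intro: order_trans)
    qed (use AM intu g_M in \<open>auto intro!: borel_measurable_integrable integrable_mult_indicator intg real_cond_exp_int(1) intU\<close>)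
    have "(\<integral>x\<in>A. U i x \<partial>M) = (\<integral>x\<in>A. ?E (U i) x \<partial>M)" for i
      by (rule real_cond_exp_intA[OF intU A])
    then show "(\<integral>x\<in>A. u x \<partial>M) = (\<integral>x\<in>A. g x \<partial>M)"
      using 1 2 LIMSEQ_unique by auto
  qed
  with AE_lim show ?thesis
    by eventually_elim simp
qed

section \<open>Sufficient sub-\<open>\<sigma>\<close>-algebras and common conditional expectations\<close>

lemma sigma_finite_subalgebra_if_law:
  assumes "Q \<in> space (prob_algebra M)" "subalgebra M C"
  shows "sigma_finite_subalgebra Q C"
proof -
  have sets: "sets Q = sets M" and "prob_space Q"
    using assms(1) by (auto simp: space_prob_algebra)
  then interpret prob_space Q by simp
  have "finite_measure_subalgebra Q C"
    using assms(2) sets_eq_imp_space_eq[OF sets] sets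
    by unfold_locales (auto simp: subalgebra_def)
  then show ?thesis
    by (rule finite_measure_subalgebra_is_sigma_finite)
qed

text \<open>
  Sufficiency speaks of conditional probabilities only, that is, of indicators; induction over the
  nonnegative measurable functions carries common versions over to conditional expectations.
\<close>

lemma sufficient_common_cond_exp_nonneg:
  fixes f :: "'a \<Rightarrow> real"
  assumes laws: "\<P> \<subseteq> space (prob_algebra M)"
    and sub: "subalgebra M C"
    and suff: "sufficient_for M C \<P>"
    and "f \<in> borel_measurable M" "\<And>x. 0 \<le> f x"
    and "\<forall>Q\<in>\<P>. integrable Q f"
  shows "\<exists>g\<in>borel_measurable C. \<forall>Q\<in>\<P>. AE x in Q. g x = real_cond_exp Q C f x"
  using assms(4-6)
proof (induction rule: borel_measurable_induct_real)
  case (set A)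
  then show ?case
    using suff by (fastforce simp: sufficient_for_def cond_prob_version_def)
next
  case (mult u c)
  show ?case
  proof (cases "c = 0")
    case True
    \<comment> \<open>Integrability of \<open>c * u\<close> says nothing about \<open>u\<close> here, so the induction hypothesis is unavailable.\<close>
    have "AE x in Q. 0 = real_cond_exp Q C (\<lambda>x. c * u x) x" if "Q \<in> \<P>" for Q
    proof -
      interpret sigma_finite_subalgebra Q C
        using laws sub that by (blast intro: sigma_finite_subalgebra_if_law)
      show ?thesis
        using real_cond_exp_F_meas[of "\<lambda>x. 0"] True by auto
    qed
    then show ?thesis
      by (intro bexI[of _ "\<lambda>x. 0"]) auto
  next
    case False
    then have int: "\<forall>Q\<in>\<P>. integrable Q u"
      using mult.prems by simp
    with mult.IH obtain g where g: "g \<in> borel_measurable C"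
      "\<forall>Q\<in>\<P>. AE x in Q. g x = real_cond_exp Q C u x" by blast
    have "AE x in Q. c * g x = real_cond_exp Q C (\<lambda>x. c * u x) x" if "Q \<in> \<P>" for Q
    proof -
      interpret sigma_finite_subalgebra Q C
        using laws sub that by (blast intro: sigma_finite_subalgebra_if_law)
      show ?thesis
        using real_cond_exp_cmult[of u c, OF int[rule_format, OF that]]
          g(2)[rule_format, OF that]
        by eventually_elim simp
    qed
    then show ?thesis
      using g(1) by (intro bexI[of _ "\<lambda>x. c * g x"]) auto
  qed
next
  case (add u v)
  have sets: "sets Q = sets M" if "Q \<in> \<P>" for Q
    using laws that by (auto simp: space_prob_algebra)
  have meas: "u \<in> borel_measurable Q" "v \<in> borel_measurable Q" if "Q \<in> \<P>" for Q
    using add.hyps(1,3) unfolding measurable_cong_sets[OF sets[OF that] refl] .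
  have int: "integrable Q u" "integrable Q v" if "Q \<in> \<P>" for Q
    using add.hyps(2,4) meas[OF that]
    by (auto intro!: Bochner_Integration.integrable_bound[OF add.prems[rule_format, OF that]])
  obtain g where g: "g \<in> borel_measurable C"
    "\<forall>Q\<in>\<P>. AE x in Q. g x = real_cond_exp Q C u x" using add.IH int by blast
  obtain k where k: "k \<in> borel_measurable C"
    "\<forall>Q\<in>\<P>. AE x in Q. k x = real_cond_exp Q C v x" using add.IH int by blast
  have "AE x in Q. k x + g x = real_cond_exp Q C (\<lambda>x. v x + u x) x" if "Q \<in> \<P>" for Q
  proof -
    interpret sigma_finite_subalgebra Q C
      using laws sub that by (blast intro: sigma_finite_subalgebra_if_law)
    show ?thesis
      using real_cond_exp_add[OF int(2,1)[OF that]] g(2)[rule_format, OF that]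
        k(2)[rule_format, OF that]
      by eventually_elim simp
  qed
  then show ?case
    using g(1) k(1) by (intro bexI[of _ "\<lambda>x. k x + g x"]) auto
next
  case (seq U)
  have sets: "sets Q = sets M" if "Q \<in> \<P>" for Q
    using laws that by (auto simp: space_prob_algebra)
  have U_le: "U i x \<le> f x" if "x \<in> space M" for i x
    using seq.hyps that by (intro incseq_le) (auto simp: incseq_def le_fun_def)
  have int: "integrable Q (U i)" if "Q \<in> \<P>" for Q i
  proof (rule Bochner_Integration.integrable_bound)
    show "integrable Q f" using seq.prems that by blast
    show "U i \<in> borel_measurable Q"
      using seq.hyps(1) unfolding measurable_cong_sets[OF sets[OF that] refl] .
    show "AE x in Q. norm (U i x) \<le> norm (f x)"
      using U_le seq.hyps(2) sets_eq_imp_space_eq[OF sets[OF that]]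
      by (intro AE_I2) (force intro: order_trans)
  qed
  have "\<exists>g. g \<in> borel_measurable C \<and> (\<forall>Q\<in>\<P>. AE x in Q. g x = real_cond_exp Q C (U i) x)" for i
    using seq.IH[of i] int by blast
  then obtain g where g: "\<And>i. g i \<in> borel_measurable C"
    "\<And>i Q. Q \<in> \<P> \<Longrightarrow> AE x in Q. g i x = real_cond_exp Q C (U i) x" by metis
  \<comment> \<open>The \<open>g i\<close> converge only outside a null set that depends on the law; \<open>lim\<close> is defined
     everywhere without reference to a law, which keeps the version common to all of them.\<close>
  have "AE x in Q. lim (\<lambda>i. g i x) = real_cond_exp Q C f x" if "Q \<in> \<P>" for Q
  proof -
    interpret sigma_finite_subalgebra Q C
      using laws sub that by (blast intro: sigma_finite_subalgebra_if_law)
    have "AE x in Q. (\<lambda>i. real_cond_exp Q C (U i) x) \<longlonglongrightarrow> real_cond_exp Q C f x"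
      using int[OF that] seq.prems seq.hyps that sets_eq_imp_space_eq[OF sets[OF that]]
      by (intro real_cond_exp_monotone_convergence) auto
    moreover have "AE x in Q. \<forall>i. g i x = real_cond_exp Q C (U i) x"
      using g(2)[OF that] by (simp add: AE_all_countable)
    ultimately show ?thesis
      by eventually_elim (simp add: limI)
  qed
  then show ?case
    using g(1) by (intro bexI[of _ "\<lambda>x. lim (\<lambda>i. g i x)"]) auto
qed

lemma sufficient_common_cond_exp:
  fixes f :: "'a \<Rightarrow> real"
  assumes laws: "\<P> \<subseteq> space (prob_algebra M)"
    and sub: "subalgebra M C"
    and suff: "sufficient_for M C \<P>"
    and f: "f \<in> borel_measurable M"
    and int: "\<And>Q. Q \<in> \<P> \<Longrightarrow> integrable Q f"
  obtains g where "g \<in> borel_measurable C"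
    and "\<And>Q. Q \<in> \<P> \<Longrightarrow> AE x in Q. g x = real_cond_exp Q C f x"
proof -
  have meas: "(\<lambda>x. max 0 (f x)) \<in> borel_measurable M"
    "(\<lambda>x. max 0 (- f x)) \<in> borel_measurable M"
    using f by measurable
  have int': "integrable Q (\<lambda>x. max 0 (f x))" "integrable Q (\<lambda>x. max 0 (- f x))"
    if "Q \<in> \<P>" for Q
    using int[OF that] by auto
  obtain g where g: "g \<in> borel_measurable C"
    "\<forall>Q\<in>\<P>. AE x in Q. g x = real_cond_exp Q C (\<lambda>x. max 0 (f x)) x"
    using sufficient_common_cond_exp_nonneg[OF laws sub suff meas(1)] int'(1)
    by (meson max.cobounded1)
  obtain k where k: "k \<in> borel_measurable C"
    "\<forall>Q\<in>\<P>. AE x in Q. k x = real_cond_exp Q C (\<lambda>x. max 0 (- f x)) x"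
    using sufficient_common_cond_exp_nonneg[OF laws sub suff meas(2)] int'(2)
    by (meson max.cobounded1)
  have "AE x in Q. g x - k x = real_cond_exp Q C f x" if "Q \<in> \<P>" for Q
  proof -
    interpret sigma_finite_subalgebra Q C
      using laws sub that by (blast intro: sigma_finite_subalgebra_if_law)
    have parts: "(\<lambda>x. max 0 (f x) - max 0 (- f x)) = f"
      by (auto simp: max_def)
    show ?thesis
      using real_cond_exp_diff[OF int'[OF that]] g(2)[rule_format, OF that]
        k(2)[rule_format, OF that]
      unfolding parts by eventually_elim simp
  qed
  then show ?thesis
    using g(1) k(1) by (intro that[of "\<lambda>x. g x - k x"]) auto
qed

section \<open>Completeness together with sufficiency\<close>

text \<open>
  The common version of the conditional expectation of \<open>f\<close> is an unbiased estimator of \<open>0\<close>, so it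
  vanishes by completeness; its integrals over the sets of \<open>C\<close> are those of \<open>f\<close>.
\<close>

lemma complete_sufficient_imp_set_integral_zero:
  fixes f :: "'a \<Rightarrow> real"
  assumes laws: "\<P> \<subseteq> space (prob_algebra M)"
    and sub: "subalgebra M C"
    and compl: "complete_for C \<P>"
    and suff: "sufficient_for M C \<P>"
    and f: "f \<in> borel_measurable M"
    and int: "\<And>Q. Q \<in> \<P> \<Longrightarrow> integrable Q f"
    and zero: "\<And>Q. Q \<in> \<P> \<Longrightarrow> (\<integral>x. f x \<partial>Q) = 0"
    and Q: "Q \<in> \<P>" and A: "A \<in> sets C"
  shows "(\<integral>x\<in>A. f x \<partial>Q) = 0"
proof -
  obtain g where gC: "g \<in> borel_measurable C"
    and g: "\<And>R. R \<in> \<P> \<Longrightarrow> AE x in R. g x = real_cond_exp R C f x"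
    using sufficient_common_cond_exp[OF laws sub suff f int] by blast
  have "integrable R g \<and> (\<integral>x. g x \<partial>R) = 0" if R: "R \<in> \<P>" for R
  proof -
    interpret sigma_finite_subalgebra R C
      using laws sub R by (blast intro: sigma_finite_subalgebra_if_law)
    have gR: "g \<in> borel_measurable R"
      by (rule measurable_from_subalg[OF subalg gC])
    show ?thesis
      using real_cond_exp_int[OF int[OF R]] zero[OF R] gR
        integrable_cong_AE[OF gR _ g[OF R]] integral_cong_AE[OF gR _ g[OF R]]
      by (simp add: borel_measurable_integrable)
  qed
  then have "AE x in Q. g x = 0"
    using compl gC Q by (auto simp: complete_for_def)
  with g[OF Q] have AE_zero: "AE x in Q. real_cond_exp Q C f x = 0"
    by eventually_elim simp
  interpret sigma_finite_subalgebra Q C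
    using laws sub Q by (blast intro: sigma_finite_subalgebra_if_law)
  have "(\<integral>x\<in>A. f x \<partial>Q) = (\<integral>x\<in>A. real_cond_exp Q C f x \<partial>Q)"
    by (rule real_cond_exp_intA[OF int[OF Q] A])
  also have "\<dots> = 0"
    unfolding set_lebesgue_integral_def
    by (rule integral_eq_zero_AE) (use AE_zero in eventually_elim, simp)
  finally show ?thesis .
qed

section \<open>Integrals over a generating \<open>\<pi>\<close>-system\<close>

text \<open>
  The sets over which \<open>f\<close> integrates to \<open>0\<close> form a Dynkin system, so they include all of \<open>S\<close>;
  hence \<open>0\<close> is a version of the conditional expectation of \<open>f\<close> given \<open>S\<close>, and so is \<open>f\<close> itself.
\<close>

lemma (in sigma_finite_subalgebra) AE_zero_if_set_integral_zero_on_pi_system: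
  fixes f :: "'a \<Rightarrow> real"
  assumes f: "f \<in> borel_measurable F" and int: "integrable M f"
    and gen: "sets F = sigma_sets (space M) G" and stable: "Int_stable G"
    and space: "space M \<in> G"
    and zero: "\<And>A. A \<in> G \<Longrightarrow> (\<integral>x\<in>A. f x \<partial>M) = 0"
  shows "AE x in M. f x = 0"
proof -
  have F_sets: "A \<in> sets M" if "A \<in> sets F" for A
    using subalg that by (auto simp: subalgebra_def)
  have set_int: "set_integrable M A f" if "A \<in> sets F" for A
    using F_sets[OF that] int unfolding set_integrable_def by (rule integrable_mult_indicator)
  have G: "G \<subseteq> Pow (space M)"
    using F_sets sets.sets_into_space gen by (blast intro: sigma_sets.Basic)
  have all_zero: "(\<integral>x\<in>A. f x \<partial>M) = 0" if "A \<in> sets F" for A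
    using stable G that[unfolded gen]
  proof (induction rule: sigma_sets_induct_disjoint)
    case (compl A)
    then have A: "A \<in> sets F" by (simp add: gen)
    have compl_A: "space M - A \<in> sets F"
      using compl(1) by (simp add: gen sigma_sets.Compl)
    have "(\<integral>x\<in>A \<union> (space M - A). f x \<partial>M)
        = (\<integral>x\<in>A. f x \<partial>M) + (\<integral>x\<in>space M - A. f x \<partial>M)"
      by (rule set_integral_Un) (use A compl_A set_int in auto)
    moreover have "A \<union> (space M - A) = space M"
      using F_sets[OF A] sets.sets_into_space by blast
    ultimately show ?case
      using compl zero[OF space] by simp
  next
    case (union A)
    then have A: "A i \<in> sets F" for i by (auto simp: gen)
    then have UA: "(\<Union>i. A i) \<in> sets F" by blast
    have "(\<integral>x\<in>(\<Union>i. A i). f x \<partial>M) = (\<Sum>i. (\<integral>x\<in>A i. f x \<partial>M))"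
      using F_sets[OF A] union(1) set_int[OF UA]
      by (intro lebesgue_integral_countable_add) (auto simp: disjoint_family_on_def)
    then show ?case using union by simp
  next
    case empty
    show ?case by (simp add: set_lebesgue_integral_def)
  qed (rule zero)
  have "AE x in M. real_cond_exp M F f x = 0"
    using all_zero int by (intro real_cond_exp_charact) (auto simp: set_lebesgue_integral_def)
  moreover have "AE x in M. real_cond_exp M F f x = f x"
    using int f by (rule real_cond_exp_F_meas)
  ultimately show ?thesis
    by eventually_elim simp
qed

lemma Int_stable_pairwise_Int:
  "Int_stable {A \<inter> B |A B. A \<in> sets C1 \<and> B \<in> sets C2}"
proof (rule Int_stableI)
  fix X Y
  assume "X \<in> {A \<inter> B |A B. A \<in> sets C1 \<and> B \<in> sets C2}"
    and "Y \<in> {A \<inter> B |A B. A \<in> sets C1 \<and> B \<in> sets C2}"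
  then obtain A B A' B' where "X = A \<inter> B" "Y = A' \<inter> B'"
    and mem: "A \<in> sets C1" "B \<in> sets C2" "A' \<in> sets C1" "B' \<in> sets C2" by blast
  then have "X \<inter> Y = (A \<inter> A') \<inter> (B \<inter> B')" by blast
  moreover have "A \<inter> A' \<in> sets C1" "B \<inter> B' \<in> sets C2"
    using mem by auto
  ultimately show "X \<inter> Y \<in> {A \<inter> B |A B. A \<in> sets C1 \<and> B \<in> sets C2}" by blast
qed

lemma sigma_sets_pairwise_Int:
  assumes "space C1 = \<Omega>" "space C2 = \<Omega>"
  shows "sigma_sets \<Omega> {A \<inter> B |A B. A \<in> sets C1 \<and> B \<in> sets C2}
       = sigma_sets \<Omega> (sets C1 \<union> sets C2)" (is "sigma_sets \<Omega> ?G = _")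
proof (rule sigma_sets_eqI)
  have sub: "sets C1 \<union> sets C2 \<subseteq> Pow \<Omega>"
    using assms sets.space_closed by blast
  fix X assume "X \<in> ?G"
  then obtain A B where X: "X = A \<inter> B" "A \<in> sets C1" "B \<in> sets C2" by blast
  from sub have "sigma_algebra \<Omega> (sigma_sets \<Omega> (sets C1 \<union> sets C2))"
    by (rule sigma_algebra_sigma_sets)
  then interpret sigma_algebra \<Omega> "sigma_sets \<Omega> (sets C1 \<union> sets C2)" .
  show "X \<in> sigma_sets \<Omega> (sets C1 \<union> sets C2)"
    using X by auto
next
  fix X assume X: "X \<in> sets C1 \<union> sets C2"
  have "X = X \<inter> \<Omega>" "X = \<Omega> \<inter> X"
    using X assms sets.sets_into_space by blast+
  moreover have "\<Omega> \<in> sets C1" "\<Omega> \<in> sets C2"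
    using assms sets.top by metis+
  ultimately have "X \<in> ?G" using X by blast
  then show "X \<in> sigma_sets \<Omega> ?G" by (rule sigma_sets.Basic)
qed

section \<open>Completeness of the join\<close>

theorem corollary1p2:
  fixes M C1 C2 :: "'a measure"
    and \<Theta>1 :: "'s set" and \<Theta>2 :: "'t set"
    and P :: "'s \<times> 't \<Rightarrow> 'a measure"
  assumes model: "P ` (\<Theta>1 \<times> \<Theta>2) \<subseteq> space (prob_algebra M)"
    and sub1: "subalgebra M C1"
    and sub2: "subalgebra M C2"
    and i: "\<And>\<theta>2. \<theta>2 \<in> \<Theta>2 \<Longrightarrow>
          complete_for C1 {P (\<theta>1, \<theta>2) |\<theta>1. \<theta>1 \<in> \<Theta>1} \<and>
          sufficient_for M C1 {P (\<theta>1, \<theta>2) |\<theta>1. \<theta>1 \<in> \<Theta>1}"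
    and ii: "\<And>\<theta>1. \<theta>1 \<in> \<Theta>1 \<Longrightarrow>
          complete_for C2 {P (\<theta>1, \<theta>2) |\<theta>2. \<theta>2 \<in> \<Theta>2} \<and>
          sufficient_for M C2 {P (\<theta>1, \<theta>2) |\<theta>2. \<theta>2 \<in> \<Theta>2}"
  shows "complete_for (sigma (space M) (sets C1 \<union> sets C2)) (P ` (\<Theta>1 \<times> \<Theta>2))"
proof -
  let ?S = "sigma (space M) (sets C1 \<union> sets C2)"
  let ?G = "{A \<inter> B |A B. A \<in> sets C1 \<and> B \<in> sets C2}"
  have spaces: "space C1 = space M" "space C2 = space M"
    and C_sets: "sets C1 \<subseteq> sets M" "sets C2 \<subseteq> sets M"
    using sub1 sub2 by (auto simp: subalgebra_def)
  have gen: "sets C1 \<union> sets C2 \<subseteq> Pow (space M)"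
    using C_sets sets.space_closed by blast
  have subS: "subalgebra M ?S"
    using gen sets.sigma_sets_subset[of "sets C1 \<union> sets C2" M] C_sets
    by (simp add: subalgebra_def)
  have S_gen: "sets ?S = sigma_sets (space M) ?G"
    using gen sigma_sets_pairwise_Int[OF spaces] by simp
  show ?thesis
    unfolding complete_for_def
  proof (intro allI impI, rule ballI)
    fix h :: "'a \<Rightarrow> real" and R
    assume hS: "h \<in> borel_measurable ?S" and "\<forall>Q\<in>P ` (\<Theta>1 \<times> \<Theta>2). integrable Q h"
      and "\<forall>Q\<in>P ` (\<Theta>1 \<times> \<Theta>2). (\<integral>x. h x \<partial>Q) = 0" and "R \<in> P ` (\<Theta>1 \<times> \<Theta>2)"
    then obtain s t where R: "R = P (s, t)" and st: "s \<in> \<Theta>1" "t \<in> \<Theta>2"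
      and int: "\<And>a b. a \<in> \<Theta>1 \<Longrightarrow> b \<in> \<Theta>2 \<Longrightarrow> integrable (P (a, b)) h"
      and zero: "\<And>a b. a \<in> \<Theta>1 \<Longrightarrow> b \<in> \<Theta>2 \<Longrightarrow> (\<integral>x. h x \<partial>P (a, b)) = 0"
      by blast
    have law: "P (a, b) \<in> space (prob_algebra M)" if "a \<in> \<Theta>1" "b \<in> \<Theta>2" for a b
      using model that by blast
    have hM: "h \<in> borel_measurable M"
      by (rule measurable_from_subalg[OF subS hS])
    have zero1: "(\<integral>x\<in>A. h x \<partial>P (a, b)) = 0"
      if A: "A \<in> sets C1" and ab: "a \<in> \<Theta>1" "b \<in> \<Theta>2" for A a b
      by (rule complete_sufficient_imp_set_integral_zero
            [OF _ sub1 i[OF ab(2), THEN conjunct1] i[OF ab(2), THEN conjunct2] hM _ _ _ A])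
         (use law int zero ab in auto)
    have zero2: "(\<integral>x\<in>A \<inter> B. h x \<partial>P (a, b)) = 0"
      if A: "A \<in> sets C1" and B: "B \<in> sets C2" and ab: "a \<in> \<Theta>1" "b \<in> \<Theta>2" for A B a b
    proof -
      have AM: "A \<in> sets M" using A C_sets by blast
      have hAM: "(\<lambda>x. indicator A x *\<^sub>R h x) \<in> borel_measurable M"
        using AM hM by measurable
      have "A \<in> sets (P (a, b'))" if "b' \<in> \<Theta>2" for b'
        using AM law[OF ab(1) that] by (simp add: space_prob_algebra)
      then have hA_int: "integrable (P (a, b')) (\<lambda>x. indicator A x *\<^sub>R h x)" if "b' \<in> \<Theta>2" for b'
        using int[OF ab(1) that] that by (blast intro: integrable_mult_indicator)
      have "(\<integral>x\<in>B. indicator A x *\<^sub>R h x \<partial>P (a, b)) = 0"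
        by (rule complete_sufficient_imp_set_integral_zero
              [OF _ sub2 ii[OF ab(1), THEN conjunct1] ii[OF ab(1), THEN conjunct2] hAM _ _ _ B])
           (use law hA_int zero1[OF A ab(1)] ab in \<open>auto simp: set_lebesgue_integral_def\<close>)
      then show ?thesis
        by (simp add: set_lebesgue_integral_def indicator_inter_arith mult_ac)
    qed
    interpret sigma_finite_subalgebra R ?S
      using law st subS unfolding R by (blast intro: sigma_finite_subalgebra_if_law)
    have space_R: "space R = space M"
      using law[OF st] sets_eq_imp_space_eq by (auto simp: R space_prob_algebra)
    show "AE x in R. h x = 0"
    proof (rule AE_zero_if_set_integral_zero_on_pi_system[OF hS _ _ Int_stable_pairwise_Int])
      show "integrable R h" unfolding R using int st by blast
      show "sets ?S = sigma_sets (space R) ?G" using S_gen space_R by simp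
      have "space M \<in> sets C1" "space M \<in> sets C2"
        using spaces sets.top by metis+
      then show "space R \<in> ?G" unfolding space_R by blast
      show "(\<integral>x\<in>A. h x \<partial>R) = 0" if "A \<in> ?G" for A
        using that zero2 st R by blast
    qed
  qed
qed

end
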